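(* Every Jordan algebra $\mathcal{A}$ of dimension two over $\mathbb{C}$ is isomorphic to the Jordan algebra $\mathbb{C}\{U,X\}$ with basis $U,X$ and unit $U$, where the product is given by one of the following: 1: $X^{\bullet2}=X$, when $\mathcal{A}\cong\mathbb{C}\times\mathbb{C}$; or 2: $X^{\bullet2}=0$, when $\mathcal{A}/\operatorname{rad}\mathcal{A}\cong\mathbb{C}$.
   Context: A Jordan algebra over $\mathbb{C}$ is a $\mathbb{C}$-vector space with a commutative bilinear product $\bullet$, having a unit, and satisfying $X^{\bullet2}\bullet(X\bullet Y)=X\bullet(X^{\bullet2}\bullet Y)$ for all $X,Y$, where $X^{\bullet2}=X\bullet X$. The radical of $\mathcal{A}$ is the ideal $\operatorname{rad}\mathcal{A}=\{X\in\mathcal{A}\mid X\bullet Y\text{ is nilpotent for all }Y\in\mathcal{A}\}$. Here $\mathbb{C}$ and $\mathbb{C}\times\mathbb{C}$ carry the usual (componentwise) multiplication. *)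

theory Defs
  imports
    "HOL-Algebra.QuotRing"
    "Jordan_Normal_Form.VS_Connect"
begin

text \<open>Algebras over the complex numbers are represented by the record \<^type>\<open>module\<close> of
  HOL-Algebra, whose ring fields carry the (not necessarily associative) product \<open>\<otimes>\<close> and the
  unit \<open>\<one>\<close>. The scalars are \<open>class_ring\<close>, the type \<^typ>\<open>complex\<close> seen as a HOL-Algebra ring.\<close>

abbreviation complex_ring :: "complex ring" where
  "complex_ring \<equiv> class_ring"

text \<open>Linearity in the second factor and the right unit law follow from commutativity.\<close>

locale jordan_algebra = vectorspace complex_ring A
  for A :: "(complex, 'a) module" (structure) +
  assumes mult_closed: "\<lbrakk>x \<in> carrier A; y \<in> carrier A\<rbrakk> \<Longrightarrow> x \<otimes> y \<in> carrier A"
    and unit_closed: "\<one> \<in> carrier A"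
    and mult_comm: "\<lbrakk>x \<in> carrier A; y \<in> carrier A\<rbrakk> \<Longrightarrow> x \<otimes> y = y \<otimes> x"
    and mult_add_left: "\<lbrakk>x \<in> carrier A; y \<in> carrier A; z \<in> carrier A\<rbrakk>
      \<Longrightarrow> (x \<oplus> y) \<otimes> z = (x \<otimes> z) \<oplus> (y \<otimes> z)"
    and mult_smult_left: "\<lbrakk>x \<in> carrier A; y \<in> carrier A\<rbrakk>
      \<Longrightarrow> (c \<odot> x) \<otimes> y = c \<odot> (x \<otimes> y)"
    and unit_left: "x \<in> carrier A \<Longrightarrow> \<one> \<otimes> x = x"
    and jordan_identity: "\<lbrakk>x \<in> carrier A; y \<in> carrier A\<rbrakk>
      \<Longrightarrow> (x \<otimes> x) \<otimes> (x \<otimes> y) = x \<otimes> ((x \<otimes> x) \<otimes> y)"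

definition has_dim :: "(complex, 'a) module \<Rightarrow> nat \<Rightarrow> bool" where
  "has_dim A n \<longleftrightarrow> vectorspace.fin_dim complex_ring A \<and> vectorspace.dim complex_ring A = n"

text \<open>Unital algebra isomorphisms.\<close>

definition alg_iso :: "(complex, 'a) module \<Rightarrow> (complex, 'b) module \<Rightarrow> ('a \<Rightarrow> 'b) set" where
  "alg_iso A B = {h \<in> ring_iso A B. \<forall>c. \<forall>x \<in> carrier A. h (c \<odot>\<^bsub>A\<^esub> x) = c \<odot>\<^bsub>B\<^esub> h x}"

definition is_alg_iso :: "(complex, 'a) module \<Rightarrow> (complex, 'b) module \<Rightarrow> bool"
    (infix \<open>\<cong>\<^sub>a\<^sub>l\<^sub>g\<close> 60) where
  "A \<cong>\<^sub>a\<^sub>l\<^sub>g B \<longleftrightarrow> alg_iso A B \<noteq> {}"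

text \<open>\<open>[^]\<close> is the left-normed power \<open>(\<dots>(x \<otimes> x) \<otimes> \<dots>) \<otimes> x\<close>; it does not presuppose
  associativity.\<close>

definition jnilpotent :: "(complex, 'a) module \<Rightarrow> 'a \<Rightarrow> bool" where
  "jnilpotent A x \<longleftrightarrow> (\<exists>n::nat. n > 0 \<and> x [^]\<^bsub>A\<^esub> n = \<zero>\<^bsub>A\<^esub>)"

definition rad :: "(complex, 'a) module \<Rightarrow> 'a set" where
  "rad A = {x \<in> carrier A. \<forall>y \<in> carrier A. jnilpotent A (x \<otimes>\<^bsub>A\<^esub> y)}"

text \<open>The quotient of an algebra by an ideal: \<^const>\<open>FactRing\<close> (which makes sense for
  non-associative products) together with the induced scalar multiplication of cosets.\<close>

definition quot_alg :: "(complex, 'a) module \<Rightarrow> 'a set \<Rightarrow> (complex, 'a set) module" where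
  "quot_alg A I = (let Q = A Quot I in
     \<lparr>carrier = carrier Q, mult = mult Q, one = one Q, zero = zero Q, add = add Q,
      smult = (\<lambda>c C. \<Union>x\<in>C. I +>\<^bsub>A\<^esub> (c \<odot>\<^bsub>A\<^esub> x))\<rparr>)"

definition alg_C :: "(complex, complex) module" where
  "alg_C = \<lparr>carrier = UNIV, mult = (*), one = 1, zero = 0, add = (+), smult = (*)\<rparr>"

definition alg_CxC :: "(complex, complex \<times> complex) module" where
  "alg_CxC = \<lparr>carrier = UNIV,
     mult = (\<lambda>(a, b) (c, d). (a * c, b * d)), one = (1, 1),
     zero = (0, 0), add = (\<lambda>(a, b) (c, d). (a + c, b + d)),
     smult = (\<lambda>k (a, b). (k * a, k * b))\<rparr>"

text \<open>The algebra with basis \<open>U, X\<close>, unit \<open>U\<close> and \<open>X\<^sup>2 = p U + q X\<close>; the pair \<open>(a, b)\<close> stands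
  for \<open>a U + b X\<close>.\<close>

definition alg_UX :: "complex \<times> complex \<Rightarrow> (complex, complex \<times> complex) module" where
  "alg_UX = (\<lambda>(p, q). \<lparr>carrier = UNIV,
     mult = (\<lambda>(a, b) (c, d). (a * c + b * d * p, a * d + b * c + b * d * q)), one = (1, 0),
     zero = (0, 0), add = (\<lambda>(a, b) (c, d). (a + c, b + d)),
     smult = (\<lambda>k (a, b). (k * a, k * b))\<rparr>)"

lemma alg_UX_products:
  "(1, 0) \<otimes>\<^bsub>alg_UX s\<^esub> v = v" "v \<otimes>\<^bsub>alg_UX s\<^esub> (1, 0) = v" "(0, 1) \<otimes>\<^bsub>alg_UX s\<^esub> (0, 1) = s"
  by (auto simp: alg_UX_def split: prod.splits)

lemma vectorspace_alg_UX: "vectorspace complex_ring (alg_UX s)"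
proof -
  obtain p q where s: "s = (p, q)" by fastforce
  have "abelian_group (alg_UX s)"
  proof (rule abelian_groupI)
    fix x assume "x \<in> carrier (alg_UX s)"
    show "\<exists>y\<in>carrier (alg_UX s). y \<oplus>\<^bsub>alg_UX s\<^esub> x = \<zero>\<^bsub>alg_UX s\<^esub>"
      by (rule bexI[of _ "(- fst x, - snd x)"]) (auto simp: alg_UX_def s split: prod.splits)
  qed (auto simp: alg_UX_def s)
  then have "module complex_ring (alg_UX s)"
    by (intro moduleI class_cring.is_cring) (auto simp: alg_UX_def s algebra_simps)
  then show ?thesis
    by (intro vectorspace.intro class_field)
qed

lemma jordan_algebra_alg_UX: "jordan_algebra (alg_UX s)"
  by (intro jordan_algebra.intro vectorspace_alg_UX jordan_algebra_axioms.intro)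
     (auto simp: alg_UX_def algebra_simps split: prod.splits)

lemma basis_alg_UX: "vectorspace.basis complex_ring (alg_UX s) {(1, 0), (0, 1)}"
proof -
  interpret vectorspace complex_ring "alg_UX s" by (rule vectorspace_alg_UX)
  have lc: "lincomb a {(1, 0), (0, 1)} = (a (1, 0), a (0, 1))" for a
  proof -
    have "lincomb a {(1, 0), (0, 1)} = a (1, 0) \<odot>\<^bsub>alg_UX s\<^esub> (1, 0) \<oplus>\<^bsub>alg_UX s\<^esub> a (0, 1) \<odot>\<^bsub>alg_UX s\<^esub> (0, 1)"
    proof -
      have c: "carrier (alg_UX s) = UNIV" by (simp add: alg_UX_def split: prod.splits)
      show ?thesis
        unfolding lincomb_def by (subst M.finsum_insert; simp add: c Pi_def)
    qed
    then show ?thesis by (auto simp: alg_UX_def split: prod.splits)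
  qed
  have "v \<in> span {(1, 0), (0, 1)}" for v
  proof -
    have "v = lincomb (\<lambda>x. if x = (1, 0) then fst v else snd v) {(1, 0), (0, 1)}"
      by (simp add: lc)
    then show ?thesis unfolding span_def by fastforce
  qed
  then have "gen_set {(1, 0), (0, 1)}" by (auto simp: alg_UX_def split: prod.splits)
  moreover have "lin_indpt {(1, 0), (0, 1)}"
  proof (rule finite_lin_indpt2)
    fix a assume "lincomb a {(1, 0), (0, 1)} = \<zero>\<^bsub>alg_UX s\<^esub>"
    then show "\<forall>v\<in>{(1, 0), (0, 1)}. a v = \<zero>\<^bsub>complex_ring\<^esub>"
      by (auto simp: lc) (auto simp: alg_UX_def split: prod.splits)
  qed (auto simp: alg_UX_def split: prod.splits)
  ultimately show ?thesis
    unfolding basis_def by (auto simp: alg_UX_def split: prod.splits)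
qed

end

theory Submission
  imports Defs
begin

text \<open>
  Since \<open>dim A = 2\<close>, the unit can be completed to a basis \<open>\<one>, X\<close>. The product is commutative and
  bilinear and \<open>\<one>\<close> is its unit, so it is determined by the two coordinates of \<open>X\<^sup>2 = p \<one> + q X\<close>
  (\<open>iso_alg_UX\<close>). In effect \<open>A\<close> is \<open>\<complex>[X]\<close> modulo a monic quadratic, and completing the square over
  \<open>\<complex>\<close> (\<open>alg_UX_complete_square\<close>) leaves two cases: distinct roots give an idempotent, a double
  root an element of square zero.

  To relate the cases to the radical, consider characters, that is, homomorphisms from \<open>A\<close> to \<open>\<complex>\<close>.
  They kill nilpotent elements and hence the radical (\<open>hom_rad\<close>). If \<open>X\<^sup>2 = 0\<close>, the coordinate of
  the unit is a character whose kernel consists of elements that have only nilpotent multiples;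
  the kernel is therefore the radical, and the homomorphism theorem (\<open>quot_kernel_iso\<close>) identifies
  the quotient with \<open>\<complex>\<close>. If \<open>X\<^sup>2 = X\<close>, the algebra has two characters with no common zero
  but \<open>0\<close>, so the radical is \<open>0\<close> and the quotient is a copy of \<open>A\<close>; this has zero divisors, which
  \<open>\<complex>\<close> has not. The two cases therefore exclude each other, which gives the equivalence with
  \<open>A / rad A \<cong> \<complex>\<close> in both directions.
\<close>

section \<open>Isomorphisms of algebras\<close>

lemma is_alg_isoI:
  fixes A :: "(complex, 'a) module" and B :: "(complex, 'b) module"
  assumes "bij_betw h (carrier A) (carrier B)"
    and "\<And>x y. x \<in> carrier A \<Longrightarrow> y \<in> carrier A \<Longrightarrow> h (x \<otimes>\<^bsub>A\<^esub> y) = h x \<otimes>\<^bsub>B\<^esub> h y"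
    and "\<And>x y. x \<in> carrier A \<Longrightarrow> y \<in> carrier A \<Longrightarrow> h (x \<oplus>\<^bsub>A\<^esub> y) = h x \<oplus>\<^bsub>B\<^esub> h y"
    and "h \<one>\<^bsub>A\<^esub> = \<one>\<^bsub>B\<^esub>"
    and "\<And>c x. x \<in> carrier A \<Longrightarrow> h (c \<odot>\<^bsub>A\<^esub> x) = c \<odot>\<^bsub>B\<^esub> h x"
  shows "A \<cong>\<^sub>a\<^sub>l\<^sub>g B"
proof -
  have "h \<in> alg_iso A B"
    using assms bij_betwE[OF assms(1)] by (auto simp: alg_iso_def ring_iso_def intro!: ring_hom_memI)
  then show ?thesis by (auto simp: is_alg_iso_def)
qed

lemma is_alg_isoE:
  fixes A :: "(complex, 'a) module" and B :: "(complex, 'b) module"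
  assumes "A \<cong>\<^sub>a\<^sub>l\<^sub>g B"
  obtains h where "bij_betw h (carrier A) (carrier B)" "h \<in> Ring.ring_hom A B"
    "\<And>c x. x \<in> carrier A \<Longrightarrow> h (c \<odot>\<^bsub>A\<^esub> x) = c \<odot>\<^bsub>B\<^esub> h x"
  using assms by (auto simp: is_alg_iso_def alg_iso_def ring_iso_def)

lemma is_alg_iso_trans:
  fixes A :: "(complex, 'a) module" and B :: "(complex, 'b) module" and C :: "(complex, 'c) module"
  assumes "A \<cong>\<^sub>a\<^sub>l\<^sub>g B" and "B \<cong>\<^sub>a\<^sub>l\<^sub>g C"
  shows "A \<cong>\<^sub>a\<^sub>l\<^sub>g C"
proof -
  obtain f where f: "bij_betw f (carrier A) (carrier B)" "f \<in> Ring.ring_hom A B"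
    "\<And>c x. x \<in> carrier A \<Longrightarrow> f (c \<odot>\<^bsub>A\<^esub> x) = c \<odot>\<^bsub>B\<^esub> f x"
    using assms(1) by (rule is_alg_isoE) auto
  obtain g where g: "bij_betw g (carrier B) (carrier C)" "g \<in> Ring.ring_hom B C"
    "\<And>c x. x \<in> carrier B \<Longrightarrow> g (c \<odot>\<^bsub>B\<^esub> x) = c \<odot>\<^bsub>C\<^esub> g x"
    using assms(2) by (rule is_alg_isoE) auto
  show ?thesis
    using bij_betw_trans[OF f(1) g(1)] ring_hom_memE[OF f(2)] ring_hom_memE[OF g(2)] f(3) g(3)
    by (intro is_alg_isoI[of "g \<circ> f"]) auto
qed

text \<open>A product of \<open>h x\<close> and \<open>h y\<close> can be pulled back because it is the image of \<open>x \<otimes> y\<close>, provided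
  that this lies in the carrier, where \<open>h\<close> is injective. Hence the closure hypotheses; they hold
  trivially for the coordinate models on a whole type.\<close>

lemma is_alg_iso_sym:
  fixes A :: "(complex, 'a) module" and B :: "(complex, 'b) module"
  assumes iso: "A \<cong>\<^sub>a\<^sub>l\<^sub>g B"
    and mult: "\<And>x y. x \<in> carrier A \<Longrightarrow> y \<in> carrier A \<Longrightarrow> x \<otimes>\<^bsub>A\<^esub> y \<in> carrier A"
    and add: "\<And>x y. x \<in> carrier A \<Longrightarrow> y \<in> carrier A \<Longrightarrow> x \<oplus>\<^bsub>A\<^esub> y \<in> carrier A"
    and one: "\<one>\<^bsub>A\<^esub> \<in> carrier A"
    and smult: "\<And>c x. x \<in> carrier A \<Longrightarrow> c \<odot>\<^bsub>A\<^esub> x \<in> carrier A"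
  shows "B \<cong>\<^sub>a\<^sub>l\<^sub>g A"
proof -
  obtain h where bij: "bij_betw h (carrier A) (carrier B)" and hom: "h \<in> Ring.ring_hom A B"
    and lin: "\<And>c x. x \<in> carrier A \<Longrightarrow> h (c \<odot>\<^bsub>A\<^esub> x) = c \<odot>\<^bsub>B\<^esub> h x"
    using iso by (rule is_alg_isoE) auto
  define g where "g = inv_into (carrier A) h"
  have g: "bij_betw g (carrier B) (carrier A)"
    unfolding g_def using bij by (rule bij_betw_inv_into)
  have gh: "g (h x) = x" if "x \<in> carrier A" for x
    unfolding g_def using bij that by (rule bij_betw_inv_into_left)
  have surj: "\<exists>x \<in> carrier A. y = h x" if "y \<in> carrier B" for y
    using that bij_betw_imp_surj_on[OF bij] by auto
  show ?thesis
  proof (rule is_alg_isoI[OF g])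
    fix u v assume "u \<in> carrier B" "v \<in> carrier B"
    then obtain x y where xy: "x \<in> carrier A" "y \<in> carrier A" "u = h x" "v = h y"
      using surj by meson
    show "g (u \<otimes>\<^bsub>B\<^esub> v) = g u \<otimes>\<^bsub>A\<^esub> g v"
      using xy mult by (simp add: gh flip: ring_hom_mult[OF hom])
    show "g (u \<oplus>\<^bsub>B\<^esub> v) = g u \<oplus>\<^bsub>A\<^esub> g v"
      using xy add by (simp add: gh flip: ring_hom_add[OF hom])
  next
    show "g \<one>\<^bsub>B\<^esub> = \<one>\<^bsub>A\<^esub>"
      using one by (simp add: gh flip: ring_hom_one[OF hom])
  next
    fix c u assume "u \<in> carrier B"
    then obtain x where "x \<in> carrier A" "u = h x" using surj by meson
    then show "g (c \<odot>\<^bsub>B\<^esub> u) = c \<odot>\<^bsub>A\<^esub> g u"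
      using smult by (simp add: gh flip: lin)
  qed
qed

section \<open>Two-dimensional algebras\<close>

lemma carrier_alg_UX [simp]: "carrier (alg_UX s) = UNIV"
  by (simp add: alg_UX_def split: prod.splits)

lemma alg_UX_ops [simp]:
  "(a, b) \<otimes>\<^bsub>alg_UX (p, q)\<^esub> (c, d) = (a * c + b * d * p, a * d + b * c + b * d * q)"
  "(a, b) \<oplus>\<^bsub>alg_UX (p, q)\<^esub> (c, d) = (a + c, b + d)"
  "\<one>\<^bsub>alg_UX (p, q)\<^esub> = (1, 0)"
  "\<zero>\<^bsub>alg_UX (p, q)\<^esub> = (0, 0)"
  "k \<odot>\<^bsub>alg_UX (p, q)\<^esub> (a, b) = (k * a, k * b)"
  by (simp_all add: alg_UX_def)

text \<open>Put \<open>Y = X - q / 2\<close>, so that \<open>Y\<^sup>2 = s\<^sup>2\<close> with \<open>s\<^sup>2 = p + q\<^sup>2 / 4\<close>. If \<open>s \<noteq> 0\<close>, then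
  \<open>E = (1 + Y / s) / 2\<close> is idempotent; if \<open>s = 0\<close>, then \<open>Y\<close> has square zero.\<close>

lemma alg_UX_complete_square:
  "alg_UX (p, q) \<cong>\<^sub>a\<^sub>l\<^sub>g alg_UX (0, 1) \<or> alg_UX (p, q) \<cong>\<^sub>a\<^sub>l\<^sub>g alg_UX (0, 0)"
proof -
  define s where "s = csqrt (p + q\<^sup>2 / 4)"
  have "s * s = p + q\<^sup>2 / 4" unfolding s_def by (metis power2_csqrt power2_eq_square)
  then have p: "p = s * s - q * q / 4" by (simp add: power2_eq_square)
  show ?thesis
  proof (cases "s = 0")
    case False
    have "alg_UX (p, q) \<cong>\<^sub>a\<^sub>l\<^sub>g alg_UX (0, 1)"
    proof (rule is_alg_isoI)
      \<comment> \<open>Since \<open>X = q / 2 + s (2 E - 1)\<close>, the element \<open>a + b X\<close> has these coordinates in \<open>1, E\<close>.\<close>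
      show "bij_betw (\<lambda>(a, b). (a + b * q / 2 - b * s, 2 * b * s))
          (carrier (alg_UX (p, q))) (carrier (alg_UX (0, 1)))"
        using False
        by (intro bij_betw_byWitness[where f' = "\<lambda>(a, b). (a - b / (2 * s) * q / 2 + b / 2, b / (2 * s))"])
           (auto simp: field_simps)
    qed (auto simp: p field_simps)
    then show ?thesis ..
  next
    case True
    have "alg_UX (p, q) \<cong>\<^sub>a\<^sub>l\<^sub>g alg_UX (0, 0)"
    proof (rule is_alg_isoI)
      \<comment> \<open>The coordinates of \<open>a + b X\<close> in the basis \<open>1, Y\<close>.\<close>
      show "bij_betw (\<lambda>(a, b). (a + b * q / 2, b))
          (carrier (alg_UX (p, q))) (carrier (alg_UX (0, 0)))"
        by (intro bij_betw_byWitness[where f' = "\<lambda>(a, b). (a - b * q / 2, b)"]) auto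
    qed (auto simp: p True field_simps)
    then show ?thesis ..
  qed
qed

text \<open>The components of the isomorphism are the two characters of \<open>\<complex>[X] / (X\<^sup>2 - X)\<close>, evaluation
  at the roots \<open>X = 0\<close> and \<open>X = 1\<close>.\<close>

lemma alg_UX_iso_alg_CxC: "alg_UX (0, 1) \<cong>\<^sub>a\<^sub>l\<^sub>g alg_CxC"
proof (rule is_alg_isoI)
  show "bij_betw (\<lambda>(a, b). (a, a + b)) (carrier (alg_UX (0, 1))) (carrier alg_CxC)"
    by (intro bij_betw_byWitness[where f' = "\<lambda>(a, b). (a, b - a)"]) (auto simp: alg_CxC_def)
qed (auto simp: alg_CxC_def algebra_simps)

lemma alg_CxC_iso_alg_UX: "alg_CxC \<cong>\<^sub>a\<^sub>l\<^sub>g alg_UX (0, 1)"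
  using alg_UX_iso_alg_CxC by (rule is_alg_iso_sym) auto

context jordan_algebra
begin

lemma zero_mult:
  assumes "x \<in> carrier A"
  shows "\<zero> \<otimes> x = \<zero>"
proof -
  have "\<zero> \<otimes> x = (0 \<odot> \<zero>) \<otimes> x" by (simp add: class_ring_simps)
  also have "\<dots> = 0 \<odot> (\<zero> \<otimes> x)" using assms by (intro mult_smult_left) auto
  also have "\<dots> = \<zero>"
    using lmult_0[of "\<zero> \<otimes> x"] assms mult_closed by (simp add: class_ring_simps)
  finally show ?thesis .
qed

text \<open>If \<open>\<one> = \<zero>\<close>, every element would be \<open>\<one> \<otimes> x = \<zero>\<close>. So the dimension forces the unit to be
  linearly independent, and it does not span the algebra.\<close>

lemma ex_unit_basis:
  assumes dim: "has_dim A 2"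
  obtains X where "X \<in> carrier A" "X \<noteq> \<one>" "basis {\<one>, X}"
proof -
  have fd: "fin_dim" and d2: "dim = 2" using dim by (auto simp: has_dim_def)
  have "\<one> \<noteq> \<zero>"
  proof
    assume "\<one> = \<zero>"
    then have "x = \<zero>" if "x \<in> carrier A" for x
      using unit_left[OF that] zero_mult[OF that] by simp
    then have "gen_set {}" by (auto simp: span_empty)
    from gen_ge_dim[OF _ _ this] show False using d2 by simp
  qed
  moreover have "lin_indpt {}" by (simp add: lin_dep_def)
  ultimately have li1: "lin_indpt {\<one>}"
    using lin_dep_iff_in_span[of "{}" \<one>] unit_closed by (simp add: span_empty)
  have "\<not> carrier A \<subseteq> span {\<one>}"
  proof
    assume "carrier A \<subseteq> span {\<one>}"
    then have "gen_set {\<one>}" using span_is_subset2[of "{\<one>}"] unit_closed by auto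
    from gen_ge_dim[OF _ _ this] show False using d2 unit_closed by simp
  qed
  then obtain X where X: "X \<in> carrier A" "X \<notin> span {\<one>}" by auto
  have "X \<noteq> \<one>" using X(2) in_own_span[of "{\<one>}"] unit_closed by auto
  then have "lin_indpt {\<one>, X}"
    using lin_dep_iff_in_span[of "{\<one>}" X] li1 X unit_closed by (simp add: insert_commute)
  then have "basis {\<one>, X}"
    using fd d2 X unit_closed \<open>X \<noteq> \<one>\<close> by (intro dim_li_is_basis) auto
  with X \<open>X \<noteq> \<one>\<close> that show ?thesis by blast
qed

lemma lincomb_pair:
  assumes "x \<in> carrier A" "y \<in> carrier A" "x \<noteq> y"
  shows "lincomb a {x, y} = a x \<odot> x \<oplus> a y \<odot> y"
  unfolding lincomb_def using assms by (subst M.finsum_insert) auto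

text \<open>For a basis \<open>\<one>, X\<close> the isomorphism is constructed in the direction \<open>(a, b) \<mapsto> a \<one> + b X\<close>, where
  it is given by a formula, and then inverted. It respects the product because expanding
  \<open>(a \<one> + b X) \<otimes> (c \<one> + d X)\<close> involves no product of basis vectors besides \<open>X \<otimes> X = p \<one> + q X\<close>
  and those with the unit.\<close>

lemma iso_alg_UX:
  assumes dim: "has_dim A 2"
  obtains p q where "A \<cong>\<^sub>a\<^sub>l\<^sub>g alg_UX (p, q)"
proof -
  obtain X where X: "X \<in> carrier A" "X \<noteq> \<one>" and basis: "basis {\<one>, X}"
    using dim by (rule ex_unit_basis)
  define h where "h = (\<lambda>(a, b). a \<odot> \<one> \<oplus> b \<odot> X)"
  have h: "h (a, b) = a \<odot> \<one> \<oplus> b \<odot> X" for a b by (simp add: h_def)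
  have lc: "lincomb a {\<one>, X} = h (a \<one>, a X)" for a
    using X unit_closed by (simp add: lincomb_pair h)
  have inC: "{\<one>, X} \<subseteq> carrier A" using X unit_closed by auto
  have closed: "h v \<in> carrier A" for v
    using X unit_closed by (cases v) (simp add: h)
  have surj: "\<exists>v. x = h v" if "x \<in> carrier A" for x
  proof -
    have "x \<in> span {\<one>, X}" using that basis by (auto simp: basis_def)
    then show ?thesis using finite_span[OF _ inC] lc by auto
  qed
  have add: "h (u \<oplus>\<^bsub>alg_UX (r, s)\<^esub> v) = h u \<oplus> h v" for r s u v
    using X unit_closed
    by (cases u; cases v) (simp add: h smult_l_distr[simplified class_ring_simps] class_ring_simps M.a_ac)
  have smult: "h (c \<odot>\<^bsub>alg_UX (r, s)\<^esub> v) = c \<odot> h v" for c r s v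
    using X unit_closed
    by (cases v) (simp add: h smult_r_distr[simplified class_ring_simps]
        smult_assoc1[simplified class_ring_simps] class_ring_simps)
  have ker: "v = (0, 0)" if "h v = \<zero>" for v
  proof -
    obtain a b where v: "v = (a, b)" by fastforce
    have "lincomb (\<lambda>x. if x = \<one> then a else b) {\<one>, X} = \<zero>"
      using that v X by (simp add: lc)
    moreover have "lin_indpt {\<one>, X}" using basis by (simp add: basis_def)
    ultimately have "(\<lambda>x. if x = \<one> then a else b) \<in> {\<one>, X} \<rightarrow> {0}"
      using not_lindepD[of "{\<one>, X}" "{\<one>, X}" "\<lambda>x. if x = \<one> then a else b"]
      by (simp add: class_ring_simps)
    then show ?thesis using X v by auto
  qed
  obtain p q where pq: "X \<otimes> X = h (p, q)"
    using surj[of "X \<otimes> X"] mult_closed X by fastforce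
  have "alg_UX (p, q) \<cong>\<^sub>a\<^sub>l\<^sub>g A"
  proof (rule is_alg_isoI)
    have "inj h"
    proof (rule injI)
      fix u v assume eq: "h u = h v"
      obtain a b c d where uv: "u = (a, b)" "v = (c, d)" by fastforce
      have "h u = h ((a - c, b - d) \<oplus>\<^bsub>alg_UX (p, q)\<^esub> v)" by (simp add: uv)
      then have "h (a - c, b - d) \<oplus> h v = h v" by (simp only: add eq)
      then have "h (a - c, b - d) = \<zero>"
        using closed by (metis M.l_zero M.add.right_cancel M.zero_closed)
      then show "u = v" using ker uv by fastforce
    qed
    then show "bij_betw h (carrier (alg_UX (p, q))) (carrier A)"
      using closed surj by (auto simp: bij_betw_def image_iff)
  next
    fix u v :: "complex \<times> complex"
    obtain a b c d where uv: "u = (a, b)" "v = (c, d)" by fastforce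
    have unit_right: "x \<otimes> \<one> = x" if "x \<in> carrier A" for x
      using mult_comm[OF that unit_closed] unit_left[OF that] by simp
    have "h u \<otimes> h v = a \<odot> (\<one> \<otimes> h v) \<oplus> b \<odot> (X \<otimes> h v)"
      using X unit_closed closed by (simp add: uv(1) h[of a] mult_add_left mult_smult_left)
    also have "X \<otimes> h v = c \<odot> X \<oplus> d \<odot> h (p, q)"
    proof -
      have "X \<otimes> h v = h v \<otimes> X" using X closed by (simp add: mult_comm)
      also have "\<dots> = c \<odot> (\<one> \<otimes> X) \<oplus> d \<odot> (X \<otimes> X)"
        using X unit_closed by (simp add: uv(2) h[of c] mult_add_left mult_smult_left)
      finally show ?thesis using X pq by (simp add: unit_left)
    qed
    also have "c \<odot> X = h (0, c)"
      using X unit_closed lmult_0[of \<one>] by (simp add: h class_ring_simps)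
    also have "\<one> \<otimes> h v = h v" using closed by (simp add: unit_left)
    finally have "h u \<otimes> h v = a \<odot> h v \<oplus> b \<odot> (h (0, c) \<oplus> d \<odot> h (p, q))" .
    also have "\<dots> = h (a \<odot>\<^bsub>alg_UX (p, q)\<^esub> v \<oplus>\<^bsub>alg_UX (p, q)\<^esub>
        b \<odot>\<^bsub>alg_UX (p, q)\<^esub> ((0, c) \<oplus>\<^bsub>alg_UX (p, q)\<^esub> d \<odot>\<^bsub>alg_UX (p, q)\<^esub> (p, q)))"
      by (simp only: add smult)
    also have "\<dots> = h (u \<otimes>\<^bsub>alg_UX (p, q)\<^esub> v)" by (simp add: uv algebra_simps)
    finally show "h (u \<otimes>\<^bsub>alg_UX (p, q)\<^esub> v) = h u \<otimes> h v" by simp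
  next
    show "h \<one>\<^bsub>alg_UX (p, q)\<^esub> = \<one>"
      using X unit_closed lmult_0[of X] smult_one[of \<one>] by (simp add: h class_ring_simps)
  qed (auto simp: add smult)
  then have "A \<cong>\<^sub>a\<^sub>l\<^sub>g alg_UX (p, q)" by (rule is_alg_iso_sym) auto
  then show thesis by (rule that)
qed

end

section \<open>The radical and its quotient\<close>

lemma alg_C_ops [simp]:
  "carrier alg_C = UNIV" "x \<otimes>\<^bsub>alg_C\<^esub> y = x * y" "x \<oplus>\<^bsub>alg_C\<^esub> y = x + y"
  "\<one>\<^bsub>alg_C\<^esub> = 1" "\<zero>\<^bsub>alg_C\<^esub> = 0" "c \<odot>\<^bsub>alg_C\<^esub> x = c * x"
  by (simp_all add: alg_C_def)

context jordan_algebra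
begin

lemma hom_zero:
  assumes "f \<in> Ring.ring_hom A alg_C"
  shows "f \<zero> = 0"
proof -
  have "f (\<zero> \<oplus> \<zero>) = f \<zero> + f \<zero>"
    using ring_hom_add[OF assms, of \<zero> \<zero>] by simp
  then show ?thesis by simp
qed

lemma nat_pow_in: "x \<in> carrier A \<Longrightarrow> x [^] (n::nat) \<in> carrier A"
  by (induction n) (auto simp: nat_pow_def intro: unit_closed mult_closed)

text \<open>Multiplicativity suffices to send the left-normed powers of \<open>x\<close> to the powers of a complex
  number, and a complex number with a vanishing power is zero.\<close>

lemma hom_nilpotent:
  assumes f: "f \<in> Ring.ring_hom A alg_C" and x: "x \<in> carrier A" and nil: "jnilpotent A x"
  shows "f x = 0"
proof -
  have "f (x [^] n) = f x ^ n" for n :: nat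
  proof (induction n)
    case 0
    then show ?case using ring_hom_one[OF f] by (simp add: nat_pow_def)
  next
    case (Suc n)
    have "x [^] Suc n = x [^] n \<otimes> x" by (simp add: nat_pow_def)
    then show ?case using Suc ring_hom_mult[OF f nat_pow_in[OF x, of n] x] by simp
  qed
  moreover obtain n :: nat where "x [^] n = \<zero>" using nil by (auto simp: jnilpotent_def)
  ultimately show ?thesis using hom_zero[OF f] by (metis power_eq_0_iff)
qed

text \<open>An element of the radical is itself nilpotent, being its own product with the unit.\<close>

lemma hom_rad:
  assumes f: "f \<in> Ring.ring_hom A alg_C" and x: "x \<in> rad A"
  shows "f x = 0"
proof -
  have x': "x \<in> carrier A" using x by (simp add: rad_def)
  have "jnilpotent A (x \<otimes> \<one>)" using x unit_closed by (auto simp: rad_def)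
  then have "jnilpotent A x" using mult_comm[OF x' unit_closed] unit_left[OF x'] by simp
  then show ?thesis using hom_nilpotent f x' by blast
qed

lemma jnilpotentI:
  assumes "x \<in> carrier A" "x \<otimes> x = \<zero>"
  shows "jnilpotent A x"
  unfolding jnilpotent_def
  using assms by (intro exI[of _ "2::nat"]) (simp add: nat_pow_def numeral_2_eq_2 unit_left)

lemma zero_in_rad: "\<zero> \<in> rad A"
  by (auto simp: rad_def zero_mult intro!: jnilpotentI)

lemma a_r_coset_eq: "I +> x = (\<lambda>y. y \<oplus> x) ` I"
  by (auto simp: a_r_coset_def')

lemma quot_alg_simps:
  "carrier (quot_alg A I) = (\<lambda>x. I +> x) ` carrier A"
  "mult (quot_alg A I) C D = (\<Union>x\<in>C. \<Union>y\<in>D. I +> (x \<otimes> y))"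
  "one (quot_alg A I) = I +> \<one>"
  "zero (quot_alg A I) = I"
  "add (quot_alg A I) C D = (\<Union>x\<in>C. \<Union>y\<in>D. {x \<oplus> y})"
  "smult (quot_alg A I) c C = (\<Union>x\<in>C. I +> (c \<odot> x))"
  by (auto simp: quot_alg_def Let_def FactRing_def A_RCOSETS_def' rcoset_mult_def set_add_def')

text \<open>The homomorphism theorem for characters. They are onto because they are linear and fix the
  unit, so the cosets of the kernel are exactly the fibres of \<open>f\<close>; sending \<open>z\<close> to the fibre over
  \<open>z\<close> is the inverse of the induced map and needs no choice of representatives.\<close>

lemma quot_kernel_iso:
  assumes f: "f \<in> Ring.ring_hom A alg_C"
    and lin: "\<And>c x. x \<in> carrier A \<Longrightarrow> f (c \<odot> x) = c * f x"
    and ker: "I = {x \<in> carrier A. f x = 0}"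
  shows "quot_alg A I \<cong>\<^sub>a\<^sub>l\<^sub>g alg_C"
proof -
  define F where "F z = {x \<in> carrier A. f x = z}" for z
  note hom = ring_hom_memE(2,3)[OF f, simplified]
  have f1: "f \<one> = 1" using ring_hom_one[OF f] by simp
  have rep: "c \<odot> \<one> \<in> F c" for c
    using unit_closed by (simp add: F_def lin f1)
  have coset: "I +> x = F (f x)" if x: "x \<in> carrier A" for x
  proof
    show "I +> x \<subseteq> F (f x)" using x by (auto simp: a_r_coset_eq F_def ker hom)
    show "F (f x) \<subseteq> I +> x"
    proof
      fix y assume y: "y \<in> F (f x)"
      have fm: "f (\<ominus> x) = - f x"
        using hom(2)[of x "\<ominus> x"] x hom_zero[OF f] M.r_neg[OF x] by (simp add: eq_neg_iff_add_eq_0 add.commute)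
      have "y \<oplus> \<ominus> x \<in> I" using x y by (simp add: F_def ker hom fm)
      moreover have "y = (y \<oplus> \<ominus> x) \<oplus> x" using x y by (simp add: F_def M.a_assoc M.l_neg)
      ultimately show "y \<in> I +> x" unfolding a_r_coset_eq by blast
    qed
  qed
  have F: "x \<in> F z \<longleftrightarrow> x \<in> carrier A \<and> f x = z" for x z by (simp add: F_def)
  have car: "carrier (quot_alg A I) = range F"
  proof -
    have "F z \<in> (\<lambda>x. I +> x) ` carrier A" for z
      using rep[of z] coset[of "z \<odot> \<one>"] by (auto simp: F)
    then show ?thesis using coset by (auto simp: quot_alg_simps)
  qed
  have "alg_C \<cong>\<^sub>a\<^sub>l\<^sub>g quot_alg A I"
  proof (rule is_alg_isoI)
    have "inj F" using rep by (metis F injI)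
    then show "bij_betw F (carrier alg_C) (carrier (quot_alg A I))"
      by (simp add: car bij_betw_def)
  next
    fix z w
    have "F z \<otimes>\<^bsub>quot_alg A I\<^esub> F w = (\<Union>x\<in>F z. \<Union>y\<in>F w. F (z * w))"
      unfolding quot_alg_simps by (intro SUP_cong refl) (simp add: F coset mult_closed hom)
    then show "F (z \<otimes>\<^bsub>alg_C\<^esub> w) = F z \<otimes>\<^bsub>quot_alg A I\<^esub> F w"
      using rep[of z] rep[of w] by auto
    have "F (z + w) \<subseteq> F z \<oplus>\<^bsub>quot_alg A I\<^esub> F w"
    proof
      fix x assume x: "x \<in> F (z + w)"
      let ?u = "z \<odot> \<one>"
      have u: "?u \<in> F z" by (rule rep)
      have fm: "f (\<ominus> ?u) = - z"
        using hom(2)[of ?u "\<ominus> ?u"] u hom_zero[OF f] M.r_neg[of ?u]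
        by (simp add: F eq_neg_iff_add_eq_0 add.commute)
      have "\<ominus> ?u \<oplus> x \<in> F w" using x u by (simp add: F hom fm)
      moreover have "x = ?u \<oplus> (\<ominus> ?u \<oplus> x)"
        using x u M.r_neg2[of ?u x] by (simp add: F)
      ultimately show "x \<in> F z \<oplus>\<^bsub>quot_alg A I\<^esub> F w"
        using u unfolding quot_alg_simps by blast
    qed
    then show "F (z \<oplus>\<^bsub>alg_C\<^esub> w) = F z \<oplus>\<^bsub>quot_alg A I\<^esub> F w"
      by (auto simp: quot_alg_simps F hom)
    have "z \<odot>\<^bsub>quot_alg A I\<^esub> F w = (\<Union>x\<in>F w. F (z * w))"
      unfolding quot_alg_simps by (intro SUP_cong refl) (simp add: F coset lin)
    then show "F (z \<odot>\<^bsub>alg_C\<^esub> w) = z \<odot>\<^bsub>quot_alg A I\<^esub> F w" using rep[of w] by auto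
  next
    show "F \<one>\<^bsub>alg_C\<^esub> = \<one>\<^bsub>quot_alg A I\<^esub>"
      using unit_closed by (simp add: quot_alg_simps coset f1)
  qed
  then show ?thesis by (rule is_alg_iso_sym) auto
qed

text \<open>With \<open>X\<^sup>2 = 0\<close> the coordinate of the unit is multiplicative, and its kernel is the ideal
  \<open>\<complex> X\<close>, all of whose elements have square zero.\<close>

lemma quot_rad_iso_if_nilpotent:
  assumes "A \<cong>\<^sub>a\<^sub>l\<^sub>g alg_UX (0, 0)"
  shows "quot_alg A (rad A) \<cong>\<^sub>a\<^sub>l\<^sub>g alg_C"
proof -
  obtain h where bij: "bij_betw h (carrier A) UNIV" and hom: "h \<in> Ring.ring_hom A (alg_UX (0, 0))"
    and lin: "\<And>c x. x \<in> carrier A \<Longrightarrow> h (c \<odot> x) = c \<odot>\<^bsub>alg_UX (0, 0)\<^esub> h x"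
    using assms by (rule is_alg_isoE) auto
  note hh = ring_hom_memE(2,3)[OF hom] ring_hom_one[OF hom]
  have f: "fst \<circ> h \<in> Ring.ring_hom A alg_C"
  proof (rule ring_hom_memI)
    fix x y assume xy: "x \<in> carrier A" "y \<in> carrier A"
    show "(fst \<circ> h) (x \<otimes> y) = (fst \<circ> h) x \<otimes>\<^bsub>alg_C\<^esub> (fst \<circ> h) y"
      "(fst \<circ> h) (x \<oplus> y) = (fst \<circ> h) x \<oplus>\<^bsub>alg_C\<^esub> (fst \<circ> h) y"
      using xy by (cases "h x"; cases "h y"; simp add: hh)+
  qed (simp_all add: hh)
  have f_lin: "(fst \<circ> h) (c \<odot> x) = c * (fst \<circ> h) x" if "x \<in> carrier A" for c x
    using lin[OF that] by (cases "h x") simp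
  have h0: "h \<zero> = (0, 0)"
    using hh(2)[of \<zero> \<zero>] by (cases "h \<zero>") simp
  have "x \<in> rad A" if x: "x \<in> carrier A" "fst (h x) = 0" for x
  proof -
    have "jnilpotent A (x \<otimes> y)" if y: "y \<in> carrier A" for y
    proof (rule jnilpotentI)
      show xy: "x \<otimes> y \<in> carrier A" using x y mult_closed by blast
      have "h ((x \<otimes> y) \<otimes> (x \<otimes> y)) = h \<zero>"
        using x y xy by (cases "h x"; cases "h y") (simp add: hh h0)
      then show "(x \<otimes> y) \<otimes> (x \<otimes> y) = \<zero>"
        using bij xy mult_closed by (auto simp: bij_betw_def dest: inj_onD)
    qed
    then show ?thesis using x by (simp add: rad_def)
  qed
  then have "rad A = {x \<in> carrier A. (fst \<circ> h) x = 0}"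
    using hom_rad[OF f] by (auto simp: rad_def)
  then show ?thesis using quot_kernel_iso[OF f f_lin] by blast
qed

text \<open>With \<open>X\<^sup>2 = X\<close> the characters \<open>a\<close> and \<open>a + b\<close> of \<open>a U + b X\<close> determine the element, so the
  radical is trivial and an isomorphism of the quotient with \<open>\<complex>\<close> would be one of \<open>A\<close> itself. It
  would have to send two nonzero elements with product zero, namely \<open>X\<close> and \<open>U - X\<close>, to nonzero
  numbers with product zero.\<close>

lemma quot_rad_not_iso_if_split:
  assumes "A \<cong>\<^sub>a\<^sub>l\<^sub>g alg_UX (0, 1)"
  shows "\<not> quot_alg A (rad A) \<cong>\<^sub>a\<^sub>l\<^sub>g alg_C"
proof
  assume "quot_alg A (rad A) \<cong>\<^sub>a\<^sub>l\<^sub>g alg_C"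
  then obtain k where bijk: "bij_betw k (carrier (quot_alg A (rad A))) UNIV"
    and homk: "k \<in> Ring.ring_hom (quot_alg A (rad A)) alg_C"
    by (rule is_alg_isoE) auto
  obtain h where bij: "bij_betw h (carrier A) UNIV" and hom: "h \<in> Ring.ring_hom A (alg_UX (0, 1))"
    using assms by (rule is_alg_isoE) auto
  note hh = ring_hom_memE(2,3)[OF hom] ring_hom_one[OF hom]
  have h0: "h \<zero> = (0, 0)"
    using hh(2)[of \<zero> \<zero>] by (cases "h \<zero>") simp
  have inj: "x = y" if "h x = h y" "x \<in> carrier A" "y \<in> carrier A" for x y
    using that bij by (auto simp: bij_betw_def dest: inj_onD)
  have f: "(\<lambda>x. fst (h x)) \<in> Ring.ring_hom A alg_C"
  proof (rule ring_hom_memI)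
    fix x y assume xy: "x \<in> carrier A" "y \<in> carrier A"
    show "fst (h (x \<otimes> y)) = fst (h x) \<otimes>\<^bsub>alg_C\<^esub> fst (h y)"
      "fst (h (x \<oplus> y)) = fst (h x) \<oplus>\<^bsub>alg_C\<^esub> fst (h y)"
      using xy by (cases "h x"; cases "h y"; simp add: hh)+
  qed (simp_all add: hh)
  have g: "(\<lambda>x. fst (h x) + snd (h x)) \<in> Ring.ring_hom A alg_C"
  proof (rule ring_hom_memI)
    fix x y assume xy: "x \<in> carrier A" "y \<in> carrier A"
    show "fst (h (x \<otimes> y)) + snd (h (x \<otimes> y)) =
        (fst (h x) + snd (h x)) \<otimes>\<^bsub>alg_C\<^esub> (fst (h y) + snd (h y))"
      "fst (h (x \<oplus> y)) + snd (h (x \<oplus> y)) =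
        (fst (h x) + snd (h x)) \<oplus>\<^bsub>alg_C\<^esub> (fst (h y) + snd (h y))"
      using xy by (cases "h x"; cases "h y"; simp add: hh algebra_simps)+
  qed (simp_all add: hh)
  have "x = \<zero>" if "x \<in> rad A" for x
  proof (rule inj)
    show "h x = h \<zero>"
      using hom_rad[OF f that] hom_rad[OF g that] by (simp add: h0 prod_eq_iff)
  qed (use that in \<open>auto simp: rad_def\<close>)
  then have rad: "rad A = {\<zero>}" using zero_in_rad by blast
  have single: "rad A +> x = {x}" if "x \<in> carrier A" for x
    using that by (simp add: rad a_r_coset_eq)
  have k_mult: "k {x \<otimes> y} = k {x} * k {y}" if "x \<in> carrier A" "y \<in> carrier A" for x y
  proof -
    have "{x} \<otimes>\<^bsub>quot_alg A (rad A)\<^esub> {y} = {x \<otimes> y}"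
      using that by (simp add: quot_alg_simps single mult_closed)
    moreover have "{x} \<in> carrier (quot_alg A (rad A))" "{y} \<in> carrier (quot_alg A (rad A))"
      using that single by (auto simp: quot_alg_simps)
    ultimately show ?thesis using ring_hom_mult[OF homk, of "{x}" "{y}"] by simp
  qed
  have zero_in: "{\<zero>} \<in> carrier (quot_alg A (rad A))"
    using single[of \<zero>] by (force simp: quot_alg_simps)
  have k0: "k {\<zero>} = 0"
    using ring_hom_add[OF homk zero_in zero_in] by (simp add: quot_alg_simps)
  have k_inj: "x = \<zero>" if x: "x \<in> carrier A" "k {x} = 0" for x
  proof -
    have "{x} \<in> carrier (quot_alg A (rad A))" using x single by (force simp: quot_alg_simps)
    then have "{x} = {\<zero>}"
      using inj_onD[OF bij_betw_imp_inj_on[OF bijk], of "{x}" "{\<zero>}"] zero_in x(2) k0 by simp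
    then show ?thesis by simp
  qed
  have "\<exists>x \<in> carrier A. h x = v" for v
    using bij by (metis UNIV_I bij_betw_def imageE)
  then obtain e e' where e: "e \<in> carrier A" "h e = (0, 1)" and e': "e' \<in> carrier A" "h e' = (1, -1)"
    by metis
  have "e \<otimes> e' = \<zero>"
    using e e' mult_closed by (intro inj) (simp_all add: hh h0)
  then have "k {e} * k {e'} = 0" using k_mult[OF e(1) e'(1)] k0 by simp
  then have "e = \<zero> \<or> e' = \<zero>" using k_inj e e' by auto
  then show False using e e' h0 by auto
qed

end

theorem proposition2p6:
  fixes A :: "(complex, 'a) module"
  assumes "jordan_algebra A" and "has_dim A 2"
  shows "(A \<cong>\<^sub>a\<^sub>l\<^sub>g alg_UX (0, 1) \<or> A \<cong>\<^sub>a\<^sub>l\<^sub>g alg_UX (0, 0)) \<and>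
    (A \<cong>\<^sub>a\<^sub>l\<^sub>g alg_UX (0, 1) \<longleftrightarrow> A \<cong>\<^sub>a\<^sub>l\<^sub>g alg_CxC) \<and>
    (A \<cong>\<^sub>a\<^sub>l\<^sub>g alg_UX (0, 0) \<longleftrightarrow> quot_alg A (rad A) \<cong>\<^sub>a\<^sub>l\<^sub>g alg_C)"
proof -
  interpret jordan_algebra A by (rule assms(1))
  obtain p q where "A \<cong>\<^sub>a\<^sub>l\<^sub>g alg_UX (p, q)" using assms(2) by (rule iso_alg_UX)
  then have "A \<cong>\<^sub>a\<^sub>l\<^sub>g alg_UX (0, 1) \<or> A \<cong>\<^sub>a\<^sub>l\<^sub>g alg_UX (0, 0)"
    using alg_UX_complete_square[of p q] is_alg_iso_trans by blast
  moreover have "A \<cong>\<^sub>a\<^sub>l\<^sub>g alg_UX (0, 1) \<longleftrightarrow> A \<cong>\<^sub>a\<^sub>l\<^sub>g alg_CxC"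
    using alg_UX_iso_alg_CxC alg_CxC_iso_alg_UX is_alg_iso_trans by blast
  ultimately show ?thesis
    using quot_rad_iso_if_nilpotent quot_rad_not_iso_if_split by blast
qed

end
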